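(* Let $A\in\mathbb{Z}^{d\times n}$ be a matrix with $\operatorname{cone}(A)$ pointed, let $Q$ be the semigroup generated by its columns, $F$ the set of fundamental holes of $Q$, and $S$ the set of saturation points of $Q$. Then \[ S=\bigcap_{f\in F}\bigl[((f+Q)\cap Q)-f\bigr], \] and hence \[ S=\Bigl\{A\lambda \;\Big|\; \lambda\in\mathbb{Z}_+^n,\ x^\lambda\in\bigcap_{f\in F} I_{A,f}\Bigr\}. \]
   Context: Let $\mathbb{Z}_+$ denote the nonnegative integers. $Q=\{A\lambda:\lambda\in\mathbb{Z}_+^n\}$; $\operatorname{cone}(A)=\{A\lambda:\lambda\in\mathbb{R}^n,\ \lambda\ge 0\}$; $\operatorname{lattice}(A)=\{A\lambda:\lambda\in\mathbb{Z}^n\}$; $Q_{\mathrm{sat}}=\operatorname{cone}(A)\cap\operatorname{lattice}(A)$. Standing assumption: $\operatorname{cone}(A)$ is pointed (contains no line). The set of holes of $Q$ is $H=Q_{\mathrm{sat}}\setminus Q$. A hole $h\in H$ is called fundamental if there is no other hole $h'\in H$ ($h'\ne h$) with $h-h'\in Q$; $F$ is the set of fundamental holes. A point $s\in Q$ is a saturation point of $Q$ if $s+Q_{\mathrm{sat}}\subseteq Q$; $S$ is the set of all saturation points. For $f\in F$, the monomial ideal $I_{A,f}\subseteq\mathbb{Q}[x_1,\ldots,x_n]$ is \[ I_{A,f}=\langle x^\lambda:\lambda\in\mathbb{Z}_+^n,\ f+A\lambda\in (f+Q)\cap Q\rangle, \] where $x^\lambda=x_1^{\lambda_1}\cdots x_n^{\lambda_n}$.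 For a set $X$ and vector $f$, $X-f=\{x-f:x\in X\}$. If $F=\emptyset$, the first intersection is understood as $Q$ (the intersection being taken among subsets of $Q$; note each set $((f+Q)\cap Q)-f$ is a subset of $Q$) and the second as the whole ring $\mathbb{Q}[x_1,\ldots,x_n]$. *)

theory Defs
  imports "HOL-Analysis.Analysis" "HOL-Library.Poly_Mapping"
begin

definition int_vec :: "nat ^ 'n \<Rightarrow> int ^ 'n" where
  "int_vec l = (\<chi> i. int (l $ i))"

definition real_vec :: "int ^ 'n \<Rightarrow> real ^ 'n" where
  "real_vec v = (\<chi> i. real_of_int (v $ i))"

definition real_mat :: "int ^ 'n ^ 'd \<Rightarrow> real ^ 'n ^ 'd" where
  "real_mat A = (\<chi> i j. real_of_int (A $ i $ j))"


definition semigroup_of :: "int ^ 'n ^ 'd \<Rightarrow> (int ^ 'd) set" where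
  "semigroup_of A = {A *v int_vec l | l. True}"

definition cone_of :: "int ^ 'n ^ 'd \<Rightarrow> (real ^ 'd) set" where
  "cone_of A = {real_mat A *v l | l. \<forall>i. 0 \<le> l $ i}"

definition lattice_of :: "int ^ 'n ^ 'd \<Rightarrow> (int ^ 'd) set" where
  "lattice_of A = {A *v l | l. True}"

definition pointed :: "'a::real_vector set \<Rightarrow> bool" where
  "pointed C \<longleftrightarrow> \<not> (\<exists>x v. v \<noteq> 0 \<and> (\<forall>t::real. x + t *\<^sub>R v \<in> C))"

(* The intersection of the cone, which lives in real space, with the lattice is
   represented by the integer vectors of the lattice lying in the cone. *)
definition saturation :: "int ^ 'n ^ 'd \<Rightarrow> (int ^ 'd) set" where
  "saturation A = {z \<in> lattice_of A. real_vec z \<in> cone_of A}"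

definition holes :: "int ^ 'n ^ 'd \<Rightarrow> (int ^ 'd) set" where
  "holes A = saturation A - semigroup_of A"

definition fundamental_holes :: "int ^ 'n ^ 'd \<Rightarrow> (int ^ 'd) set" where
  "fundamental_holes A =
     {h \<in> holes A. \<not> (\<exists>h' \<in> holes A. h' \<noteq> h \<and> h - h' \<in> semigroup_of A)}"

definition saturation_points :: "int ^ 'n ^ 'd \<Rightarrow> (int ^ 'd) set" where
  "saturation_points A =
     {s \<in> semigroup_of A. (\<lambda>q. s + q) ` saturation A \<subseteq> semigroup_of A}"


(* The polynomial ring over the rationals in variables indexed by 'n: finitely supported
   maps from exponent vectors to coefficients, with the convolution product. *)
type_synonym 'n rat_mpoly = "('n \<Rightarrow>\<^sub>0 nat) \<Rightarrow>\<^sub>0 rat"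

definition var :: "'n \<Rightarrow> 'n rat_mpoly" where
  "var i = Poly_Mapping.single (Poly_Mapping.single i 1) 1"

definition monomial :: "nat ^ 'n \<Rightarrow> 'n rat_mpoly" where
  "monomial l = (\<Prod>i\<in>UNIV. var i ^ (l $ i))"

lemma module_times: "module ((*) :: 'a::comm_ring_1 \<Rightarrow> 'a \<Rightarrow> 'a)"
  by standard (simp_all add: algebra_simps)

(* An ideal of a commutative ring is a submodule of the ring regarded as a module over itself. *)
definition ideal_gen :: "'a::comm_ring_1 set \<Rightarrow> 'a set" where
  "ideal_gen B = module.span (*) B"

definition hole_ideal :: "int ^ 'n ^ 'd \<Rightarrow> int ^ 'd \<Rightarrow> ('n rat_mpoly) set" where
  "hole_ideal A f = ideal_gen
     {monomial l | l. f + A *v int_vec l \<in> (\<lambda>q. f + q) ` semigroup_of A \<inter> semigroup_of A}"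

end

theory Submission
  imports Defs
begin

text \<open>
  Pointedness separates the origin from the nonzero columns of the matrix: some linear functional is
  at least 1 on each of them. It is nonnegative on the cone and at least 1 on every nonzero element
  of the semigroup, so subtracting semigroup elements from a hole terminates, and every hole
  is the sum of a fundamental hole and a semigroup element. Hence a semigroup element is a saturation
  point as soon as it moves every fundamental hole into the semigroup. Since the exponents with this
  property for a given hole are closed under addition of arbitrary exponents, they are exactly the
  exponents of the monomials in the corresponding monomial ideal.
\<close>

section \<open>Coercions and closure properties of the semigroup and the cone\<close>

lemma real_vec_mult:
  "real_vec (A *v x) = real_mat A *v real_vec x"
  by (simp add: real_vec_def real_mat_def matrix_vector_mult_def vec_eq_iff)

lemma real_vec_diff: "real_vec (x - y) = real_vec x - real_vec y"
  by (simp add: real_vec_def vec_eq_iff)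

lemma real_vec_eq_0_iff: "real_vec x = 0 \<longleftrightarrow> x = 0"
  by (simp add: real_vec_def vec_eq_iff)

lemma int_vec_add: "int_vec (l + m) = int_vec l + int_vec m"
  by (simp add: int_vec_def vec_eq_iff)

lemma semigroup_of_add:
  assumes "x \<in> semigroup_of A" "y \<in> semigroup_of A"
  shows "x + y \<in> semigroup_of A"
proof -
  obtain l m where "x = A *v int_vec l" "y = A *v int_vec m"
    using assms by (auto simp: semigroup_of_def)
  then have "x + y = A *v int_vec (l + m)"
    by (simp add: int_vec_add matrix_vector_right_distrib)
  then show ?thesis by (auto simp: semigroup_of_def)
qed

lemma zero_in_semigroup_of: "0 \<in> semigroup_of A"
proof -
  have "A *v int_vec 0 = 0"
    by (simp add: int_vec_def matrix_vector_mult_def vec_eq_iff)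
  then show ?thesis unfolding semigroup_of_def by (metis (mono_tags, lifting) mem_Collect_eq)
qed

lemma zero_in_cone_of: "0 \<in> cone_of A"
  by (force simp: cone_of_def intro: exI[of _ 0])

lemma cone_of_add:
  assumes "x \<in> cone_of A" "y \<in> cone_of A"
  shows "x + y \<in> cone_of A"
proof -
  obtain l m where "x = real_mat A *v l" "\<forall>i. 0 \<le> l $ i" "y = real_mat A *v m" "\<forall>i. 0 \<le> m $ i"
    using assms by (auto simp: cone_of_def)
  then have "x + y = real_mat A *v (l + m)" "\<forall>i. 0 \<le> (l + m) $ i"
    by (simp_all add: matrix_vector_right_distrib)
  then show ?thesis unfolding cone_of_def by blast
qed

lemma cone_of_scaleR:
  assumes "x \<in> cone_of A" "0 \<le> t"
  shows "t *\<^sub>R x \<in> cone_of A"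
proof -
  obtain l where "x = real_mat A *v l" "\<forall>i. 0 \<le> l $ i"
    using assms by (auto simp: cone_of_def)
  then have "t *\<^sub>R x = real_mat A *v (t *\<^sub>R l)" "\<forall>i. 0 \<le> (t *\<^sub>R l) $ i"
    using assms by (simp_all add: matrix_vector_mult_scaleR)
  then show ?thesis unfolding cone_of_def by blast
qed

lemma cone_of_sum:
  assumes "finite I" "\<And>i. i \<in> I \<Longrightarrow> g i \<in> cone_of A"
  shows "sum g I \<in> cone_of A"
  using assms by (induction I) (auto intro: zero_in_cone_of cone_of_add)

lemma column_in_cone_of: "column j (real_mat A) \<in> cone_of A"
proof -
  have "column j (real_mat A) = real_mat A *v axis j 1"
    by (simp add: matrix_vector_mult_basis)
  moreover have "\<forall>i. 0 \<le> axis j (1::real) $ i"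
    by (simp add: axis_def)
  ultimately show ?thesis unfolding cone_of_def by blast
qed

section \<open>Separating the origin from the nonzero columns\<close>

text \<open>The rays through \<open>v\<close> and \<open>- v\<close> both lie in the cone, so a
  nonzero \<open>v\<close> would span a line inside it.\<close>

lemma pointed_cone_of_antisym:
  assumes "pointed (cone_of A)" "v \<in> cone_of A" "- v \<in> cone_of A"
  shows "v = 0"
proof (rule ccontr)
  assume "v \<noteq> 0"
  have "0 + t *\<^sub>R v \<in> cone_of A" for t
  proof (cases "0 \<le> t")
    case True
    then show ?thesis using assms(2) by (simp add: cone_of_scaleR)
  next
    case False
    then show ?thesis using cone_of_scaleR[OF assms(3), of "- t"] by simp
  qed
  with \<open>v \<noteq> 0\<close> assms(1) show False unfolding pointed_def by blast
qed

text \<open>In a vanishing convex combination of nonzero columns, a term with positive weight is the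
  negative of the sum of the others. Both are in the cone, so antisymmetry kills the term.\<close>

lemma pointed_zero_notin_hull:
  assumes "pointed (cone_of A)"
  shows "0 \<notin> convex hull (range (\<lambda>j. column j (real_mat A)) - {0})"
proof
  let ?C = "range (\<lambda>j. column j (real_mat A)) - {0}"
  have fin: "finite ?C" by simp
  assume "0 \<in> convex hull ?C"
  then obtain u where u: "\<forall>x\<in>?C. 0 \<le> u x" "sum u ?C = 1" "(\<Sum>x\<in>?C. u x *\<^sub>R x) = 0"
    unfolding convex_hull_finite[OF fin] by blast
  from u(2) have "\<exists>v\<in>?C. u v \<noteq> 0"
    by (metis sum.neutral zero_neq_one)
  then obtain v where v: "v \<in> ?C" "u v > 0"
    using u(1) by (metis less_eq_real_def)
  have in_cone: "x \<in> ?C \<Longrightarrow> u x *\<^sub>R x \<in> cone_of A" for x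
    using u(1) by (auto intro: cone_of_scaleR column_in_cone_of)
  have "- (u v *\<^sub>R v) = (\<Sum>x\<in>?C - {v}. u x *\<^sub>R x)"
    using u(3) sum.remove[OF fin v(1), of "\<lambda>x. u x *\<^sub>R x"]
    by (intro minus_unique) simp
  also have "\<dots> \<in> cone_of A"
    using in_cone fin by (intro cone_of_sum) auto
  finally have "u v *\<^sub>R v = 0"
    using pointed_cone_of_antisym[OF assms in_cone[OF v(1)]] by simp
  with v show False by simp
qed

text \<open>The hull of finitely many points is compact, so a hyperplane separates it strictly from
  the origin.\<close>

lemma pointed_positive_functional:
  assumes "pointed (cone_of A)"
  obtains c where "\<And>j. column j (real_mat A) \<noteq> 0 \<Longrightarrow> 1 \<le> c \<bullet> column j (real_mat A)"
proof -
  let ?C = "range (\<lambda>j. column j (real_mat A)) - {0}"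
  have "closed (convex hull ?C)"
    by (intro compact_imp_closed finite_imp_compact_convex_hull) simp
  then obtain a b where ab: "b > 0" "\<forall>x\<in>convex hull ?C. a \<bullet> x > b"
    using separating_hyperplane_closed_0[OF convex_convex_hull _ pointed_zero_notin_hull[OF assms]]
    by blast
  show ?thesis
  \<comment> \<open>Dividing by the gap \<open>b\<close> normalizes the strict bound
    \<open>b\<close> to 1.\<close>
  proof (rule that[of "a /\<^sub>R b"])
    fix j assume "column j (real_mat A) \<noteq> 0"
    then have "b < a \<bullet> column j (real_mat A)"
      using ab(2) by (simp add: hull_inc)
    with ab(1) show "1 \<le> (a /\<^sub>R b) \<bullet> column j (real_mat A)"
      by (simp add: field_simps)
  qed
qed

section \<open>Descent on holes along the functional\<close>

lemma inner_real_mat_mult: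
  "c \<bullet> (M *v x) = (\<Sum>j\<in>UNIV. x $ j * (c \<bullet> column j M))" for M :: "real ^ 'n ^ 'd"
  by (simp add: matrix_mult_sum inner_sum_right scalar_mult_eq_scaleR)

context
  fixes A :: "int ^ 'n ^ 'd" and c :: "real ^ 'd"
  assumes c: "\<And>j. column j (real_mat A) \<noteq> 0 \<Longrightarrow> 1 \<le> c \<bullet> column j (real_mat A)"
begin

lemma functional_column_nonneg: "0 \<le> c \<bullet> column j (real_mat A)"
  using c[of j] by (cases "column j (real_mat A) = 0") auto

lemma functional_cone_nonneg: "x \<in> cone_of A \<Longrightarrow> 0 \<le> c \<bullet> x"
  by (auto simp: cone_of_def inner_real_mat_mult intro!: sum_nonneg mult_nonneg_nonneg
      functional_column_nonneg)

text \<open>Integrality enters here: a nonzero element uses some nonzero column with a positive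
  integer coefficient, which alone contributes at least 1, and no other column contributes
  negatively.\<close>

lemma functional_semigroup_ge_1:
  assumes "q \<in> semigroup_of A" "q \<noteq> 0"
  shows "1 \<le> c \<bullet> real_vec q"
proof -
  obtain l where l: "q = A *v int_vec l"
    using assms(1) by (auto simp: semigroup_of_def)
  let ?a = "\<lambda>j. column j (real_mat A)"
  have q: "real_vec q = real_mat A *v real_vec (int_vec l)"
    by (simp add: l real_vec_mult)
  then have "(\<Sum>j\<in>UNIV. real (l $ j) *\<^sub>R ?a j) \<noteq> 0"
    using assms(2) real_vec_eq_0_iff[of q]
    by (simp add: matrix_mult_sum scalar_mult_eq_scaleR real_vec_def int_vec_def)
  then obtain j where j: "real (l $ j) *\<^sub>R ?a j \<noteq> 0"
    by (meson sum.neutral)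
  then have "1 \<le> real (l $ j)" "1 \<le> c \<bullet> ?a j"
    using c[of j] by auto
  then have "1 \<le> real (l $ j) * (c \<bullet> ?a j)"
    using mult_mono[of 1 "real (l $ j)" 1 "c \<bullet> ?a j"] by simp
  also have "\<dots> \<le> (\<Sum>j\<in>UNIV. real (l $ j) * (c \<bullet> ?a j))"
    by (rule member_le_sum) (auto intro: mult_nonneg_nonneg functional_column_nonneg)
  also have "\<dots> = c \<bullet> real_vec q"
    unfolding q inner_real_mat_mult by (simp add: real_vec_def int_vec_def)
  finally show ?thesis .
qed

lemma hole_decomposition_functional:
  assumes "h \<in> holes A"
  shows "\<exists>f\<in>fundamental_holes A. h - f \<in> semigroup_of A"
  using assms
proof (induction "nat \<lfloor>c \<bullet> real_vec h\<rfloor>" arbitrary: h rule: less_induct)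
  case less
  show ?case
  proof (cases "h \<in> fundamental_holes A")
    case True
    \<comment> \<open>The witness is \<open>h\<close> itself, with difference 0.\<close>
    then show ?thesis using zero_in_semigroup_of by force
  next
    case False
    then obtain h' where h': "h' \<in> holes A" "h' \<noteq> h" "h - h' \<in> semigroup_of A"
      using less.prems by (auto simp: fundamental_holes_def)
    have "0 \<le> c \<bullet> real_vec h'"
      using h'(1) by (intro functional_cone_nonneg) (simp add: holes_def saturation_def)
    moreover have "1 \<le> c \<bullet> real_vec (h - h')"
      using h' by (intro functional_semigroup_ge_1) auto
    \<comment> \<open>A drop of at least 1 lowers the floor, and nonnegativity at \<open>h'\<close>
      keeps \<open>nat\<close> from truncating.\<close>
    ultimately have "nat \<lfloor>c \<bullet> real_vec h'\<rfloor> < nat \<lfloor>c \<bullet> real_vec h\<rfloor>"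
      by (simp add: real_vec_diff inner_diff_right) linarith
    from less.hyps[OF this h'(1)] obtain f
      where f: "f \<in> fundamental_holes A" "h' - f \<in> semigroup_of A" by blast
    have "h - f = (h - h') + (h' - f)" by simp
    then show ?thesis using f semigroup_of_add[OF h'(3) f(2)] by auto
  qed
qed

end

section \<open>Testing saturation points on fundamental holes\<close>

lemma hole_decomposition:
  assumes "pointed (cone_of A)" "h \<in> holes A"
  obtains f where "f \<in> fundamental_holes A" "h - f \<in> semigroup_of A"
  using pointed_positive_functional[OF assms(1)] hole_decomposition_functional[OF _ assms(2)]
  by metis

lemma saturation_points_iff:
  assumes "pointed (cone_of A)"
  shows "s \<in> saturation_points A \<longleftrightarrow>
    s \<in> semigroup_of A \<and> (\<forall>f\<in>fundamental_holes A. f + s \<in> semigroup_of A)" (is "?L \<longleftrightarrow> ?R")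
proof
  assume ?L
  then show ?R
    by (auto simp: saturation_points_def fundamental_holes_def holes_def add.commute)
next
  assume R: ?R
  have "s + q \<in> semigroup_of A" if q: "q \<in> saturation A" for q
  proof (cases "q \<in> semigroup_of A")
    case True
    then show ?thesis using R semigroup_of_add by blast
  next
    case False
    then have "q \<in> holes A" using q by (simp add: holes_def)
    then obtain f where f: "f \<in> fundamental_holes A" "q - f \<in> semigroup_of A"
      using hole_decomposition[OF assms] by blast
    have "s + q = (f + s) + (q - f)" by simp
    then show ?thesis using R f semigroup_of_add by metis
  qed
  with R show ?L by (auto simp: saturation_points_def)
qed

section \<open>Monomials and monomial ideals\<close>

lemma var_power: "var i ^ k = Poly_Mapping.single (Poly_Mapping.single i k) 1"
  by (induction k) (simp_all add: var_def mult_single single_add[symmetric] flip: single_one)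

lemma monomial_eq_single:
  "monomial l = Poly_Mapping.single (\<Sum>i\<in>UNIV. Poly_Mapping.single i (l $ i)) 1"
proof -
  have "(\<Prod>i\<in>I. var i ^ (l $ i)) = Poly_Mapping.single (\<Sum>i\<in>I. Poly_Mapping.single i (l $ i)) 1"
    if "finite I" for I
    using that by induction (simp_all add: var_power mult_single)
  then show ?thesis by (simp add: monomial_def)
qed

lemma keys_monomial:
  "Poly_Mapping.keys (monomial l) = {\<Sum>i\<in>UNIV. Poly_Mapping.single i (l $ i)}"
  by (simp add: monomial_eq_single)

lemma lookup_sum_single:
  "Poly_Mapping.lookup (\<Sum>i\<in>UNIV. Poly_Mapping.single i (l $ i)) j = l $ j" for l :: "nat ^ 'n"
  by (simp add: lookup_sum lookup_single when_def)

text \<open>For an upward closed \<open>P\<close>, the polynomials all of whose exponents satisfy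
  \<open>P\<close> form an ideal. It contains the generators, hence everything they
  generate.\<close>

lemma monomial_in_ideal_gen_iff:
  fixes P :: "nat ^ 'n \<Rightarrow> bool"
  assumes up: "\<And>l m. P l \<Longrightarrow> P (m + l)"
  shows "monomial l \<in> ideal_gen {monomial l | l. P l} \<longleftrightarrow> P l"
proof
  assume "P l"
  then show "monomial l \<in> ideal_gen {monomial l | l. P l}"
    unfolding ideal_gen_def by (blast intro: module.span_base[OF module_times])
next
  \<comment> \<open>The vector inside \<open>P\<close> turns an exponent of the polynomial ring back
    into the type of \<open>l\<close>.\<close>
  let ?V = "{p :: 'n rat_mpoly. \<forall>e\<in>Poly_Mapping.keys p. P (\<chi> i. Poly_Mapping.lookup e i)}"
  have "module.subspace (*) ?V"
  proof (rule module.subspaceI[OF module_times])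
    show "0 \<in> ?V" by simp
  next
    fix x y assume "x \<in> ?V" "y \<in> ?V"
    then show "x + y \<in> ?V" using Poly_Mapping.keys_add[of x y] by blast
  next
    fix a x assume x: "x \<in> ?V"
    show "a * x \<in> ?V"
    proof safe
      fix e assume "e \<in> Poly_Mapping.keys (a * x)"
      then obtain u v where e: "e = u + v" "v \<in> Poly_Mapping.keys x"
        using keys_mult[of a x] by blast
      have "(\<chi> i. Poly_Mapping.lookup e i) =
          (\<chi> i. Poly_Mapping.lookup u i) + (\<chi> i. Poly_Mapping.lookup v i)"
        by (simp add: e(1) lookup_add vec_eq_iff)
      then show "P (\<chi> i. Poly_Mapping.lookup e i)" using x e(2) up by simp
    qed
  qed
  moreover have "{monomial l | l. P l} \<subseteq> ?V"
    by (auto simp: keys_monomial lookup_sum_single)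
  ultimately have "ideal_gen {monomial l | l. P l} \<subseteq> ?V"
    unfolding ideal_gen_def by (intro module.span_minimal[OF module_times])
  moreover assume "monomial l \<in> ideal_gen {monomial l | l. P l}"
  ultimately show "P l"
    by (auto simp: keys_monomial lookup_sum_single)
qed

lemma monomial_in_hole_ideal_iff:
  "monomial l \<in> hole_ideal A f \<longleftrightarrow> f + A *v int_vec l \<in> semigroup_of A"
proof -
  have mem: "A *v int_vec l \<in> semigroup_of A" for l
    by (auto simp: semigroup_of_def)
  \<comment> \<open>Membership in the translate of the semigroup by \<open>f\<close> is
    automatic.\<close>
  have "hole_ideal A f = ideal_gen {monomial l | l. f + A *v int_vec l \<in> semigroup_of A}"
    using mem by (simp add: hole_ideal_def)
  moreover have "f + A *v int_vec (m + l) \<in> semigroup_of A"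
    if "f + A *v int_vec l \<in> semigroup_of A" for l m
    using semigroup_of_add[OF mem[of m] that]
    by (simp add: int_vec_add matrix_vector_right_distrib add_ac)
  ultimately show ?thesis
    using monomial_in_ideal_gen_iff[of "\<lambda>l. f + A *v int_vec l \<in> semigroup_of A"] by simp
qed

theorem theorem7p1:
  fixes A :: "int ^ 'n ^ 'd"
  assumes "pointed (cone_of A)"
  shows "saturation_points A =
           semigroup_of A \<inter>
           (\<Inter>f \<in> fundamental_holes A.
             (\<lambda>x. x - f) ` ((\<lambda>q. f + q) ` semigroup_of A \<inter> semigroup_of A))
       \<and> saturation_points A =
           {A *v int_vec l | l. monomial l \<in> (\<Inter>f \<in> fundamental_holes A. hole_ideal A f)}"
proof
  \<comment> \<open>Shifting back by \<open>f\<close> turns each set of the intersection into the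
    condition of \<open>saturation_points_iff\<close> at \<open>f\<close>.\<close>
  have mem: "s \<in> (\<lambda>x. x - f) ` ((\<lambda>q. f + q) ` semigroup_of A \<inter> semigroup_of A) \<longleftrightarrow>
      s \<in> semigroup_of A \<and> f + s \<in> semigroup_of A" for s f
    by (force simp: image_iff)
  show "saturation_points A =
           semigroup_of A \<inter>
           (\<Inter>f \<in> fundamental_holes A.
             (\<lambda>x. x - f) ` ((\<lambda>q. f + q) ` semigroup_of A \<inter> semigroup_of A))"
    by (intro set_eqI, simp only: Int_iff INT_iff mem saturation_points_iff[OF assms]) blast
  show "saturation_points A =
           {A *v int_vec l | l. monomial l \<in> (\<Inter>f \<in> fundamental_holes A. hole_ideal A f)}"
    \<comment> \<open>Without fundamental holes the intersection of ideals is the whole ring, and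
      both sides are the semigroup.\<close>
    using saturation_points_iff[OF assms]
    by (auto simp: monomial_in_hole_ideal_iff semigroup_of_def[of A])
qed

end
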